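(* Let $n\ge 2$, let $m_1\ge\cdots\ge m_n$ be integers, let $R$ be the associated Gelfand–Tsetlin $sl_n$-module, and let $\beta\in R$ be the pattern with $m_{i,k}=m_i$ for all $1\le i\le k\le n$. For each basis vector (pattern) $\xi$ of $R$ let $a(\xi)\in\mathbb{Z}_{\ge0}^{N}$, $N=\frac{n(n-1)}{2}$, be its exponent vector (defined in the context), and let $$B=\{a(\xi)\mid \xi\text{ is a basis element}\}.$$ Then $$\{F^{a(\xi)}\cdot\beta\mid a(\xi)\in B\}$$ is a basis of $R$, where, for $a=(a_1,\dots,a_N)$, $$F^{a}=\left(F_{2,1}^{a_1}F_{3,2}^{a_2}\cdots F_{n,n-1}^{a_{n-1}}\right)\cdots\left(F_{2,1}^{a_{N-2}}F_{3,2}^{a_{N-1}}\right)F_{2,1}^{a_N}.$$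
   Context: Here $sl_n=sl_n(\mathbb{C})$ is the Lie algebra of $n\times n$ complex matrices of trace $0$. Patterns. Fix integers $m_1\ge\cdots\ge m_n$. A Gelfand–Tsetlin pattern $\xi$ with top row $(m_1,\dots,m_n)$ is a family of integers $m_{i,k}$, $1\le i\le k\le n$, with $m_{i,n}=m_i$ for all $i$ and $m_{i,k}\ge m_{i,k-1}\ge m_{i+1,k}$ for $1\le i\le k-1\le n-1$. (The entries $m_{1,k},\dots,m_{k,k}$ form the row of length $k$.) $R$ is the $\mathbb{C}$-vector space with basis the (finite) set of all such patterns. Action. Put $l_{p,q}=m_{p,q}-p$. For $2\le k\le n$ and $1\le j\le k-1$ let $\xi_{k-1,k}^{j}$ (resp. $\bar\xi_{k,k-1}^{j}$) be obtained from $\xi$ by replacing $m_{j,k-1}$ by $m_{j,k-1}+1$ (resp. $m_{j,k-1}-1$). Set $$a_{k-1,k}^j=\left[-\frac{\prod_{i=1}^k(l_{i,k}-l_{j,k-1})\prod_{i=1}^{k-2}(l_{i,k-2}-l_{j,k-1}-1)}{\prod_{i\neq j}(l_{i,k-1}-l_{j,k-1})(l_{i,k-1}-l_{j,k-1}-1)}\right]^{1/2},$$ $$b_{k,k-1}^j=\left[-\frac{\prod_{i=1}^k(l_{i,k}-l_{j,k-1}+1)\prod_{i=1}^{k-2}(l_{i,k-2}-l_{j,k-1})}{\prod_{i\neq j}(l_{i,k-1}-l_{j,k-1}+1)(l_{i,k-1}-l_{j,k-1})}\right]^{1/2},$$ where in the denominators $1\le i\le k-1$, empty products are $1$, and square roots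 are nonnegative. Operators on $R$ are defined by $$E_{k-1,k}\xi=\sum_j a_{k-1,k}^j\,\xi_{k-1,k}^j,\qquad F_{k,k-1}\xi=\sum_j b_{k,k-1}^j\,\bar\xi_{k,k-1}^j,\qquad H_{k,k}\xi=\Big(\sum_{i=1}^k m_{i,k}-\sum_{i=1}^{k-1}m_{i,k-1}\Big)\xi \ (1\le k\le n),$$ where each sum runs only over those $j$ for which the modified array is again a pattern. The matrix units $e_{k-1,k}$, $e_{k,k-1}$ act by $E_{k-1,k}$, $F_{k,k-1}$, and $e_{k,k}-e_{k+1,k+1}$ acts by $H_{k,k}-H_{k+1,k+1}$; the other off-diagonal matrix units act by iterated commutators, e.g. $E_{1,3}=[E_{1,2},E_{2,3}]$. By Gelfand and Tsetlin, this makes $R$ an $sl_n$-module. Exponent vectors. For $a=(a_1,\dots,a_N)\in\mathbb{Z}_{\ge0}^N$ let $$E^{a}=E_{1,2}^{a_N}\left(E_{2,3}^{a_{N-1}}E_{1,2}^{a_{N-2}}\right)\cdots\left(E_{n-1,n}^{a_{n-1}}\cdots E_{2,3}^{a_2}E_{1,2}^{a_1}\right);$$ the blocks from right to left are $E_{r,r+1}^{\ast}\cdots E_{2,3}^{\ast}E_{1,2}^{\ast}$ for $r=n-1,\dots,1$, with exponents $a_1,\dots,a_N$ assigned from right to left. For a pattern $\xi$, the vector $a(\xi)=(a_1,\dots,a_N)$ is the one obtained by applying each operator maximally, from right to left: $a_1$ is the largest integer with $E_{1,2}^{a_1}\xi\ne0$, and, successively, $a_t$ is the largest integer such that applying the $t$-th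 factor (counted from the right) to the power $a_t$ to the vector already obtained gives a nonzero vector. It satisfies $E^{a(\xi)}\xi=\lambda_\beta\beta$ with $\lambda_\beta\ne0$. The operator $F^a$ is the product of the corresponding lowering operators ($E_{k-1,k}$ replaced by $F_{k,k-1}$) in the reverse order. *)

theory Defs
  imports Complex_Main "HOL-Library.Poly_Mapping"
begin

(* An array \<xi> has the integer \<xi> i k in position i of the row of length k.
   Entries outside 1 \<le> i \<le> k \<le> n are pinned to 0 in gt_patterns, so that equality of
   patterns is equality of functions. *)
type_synonym gt_array = "nat \<Rightarrow> nat \<Rightarrow> int"

definition gt_patterns :: "nat \<Rightarrow> (nat \<Rightarrow> int) \<Rightarrow> gt_array set" where
  "gt_patterns n m = {\<xi>.
     (\<forall>i\<in>{1..n}. \<xi> i n = m i) \<and>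
     (\<forall>k\<in>{2..n}. \<forall>i\<in>{1..k-1}. \<xi> i k \<ge> \<xi> i (k-1) \<and> \<xi> i (k-1) \<ge> \<xi> (i+1) k) \<and>
     (\<forall>i k. \<not> (1 \<le> i \<and> i \<le> k \<and> k \<le> n) \<longrightarrow> \<xi> i k = 0)}"

definition gt_top_pattern :: "nat \<Rightarrow> (nat \<Rightarrow> int) \<Rightarrow> gt_array" where
  "gt_top_pattern n m = (\<lambda>i k. if 1 \<le> i \<and> i \<le> k \<and> k \<le> n then m i else 0)"

text \<open>Complex vectors on arrays are finitely supported functions; the space \<open>R\<close> consists of
  those supported on patterns.\<close>

type_synonym gt_vec = "gt_array \<Rightarrow>\<^sub>0 complex"

definition gt_scale :: "complex \<Rightarrow> gt_vec \<Rightarrow> gt_vec" where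
  "gt_scale c v = Poly_Mapping.map (\<lambda>x. c * x) v"

lemma lookup_gt_scale [simp]: "Poly_Mapping.lookup (gt_scale c v) \<xi> = c * Poly_Mapping.lookup v \<xi>"
  by (simp add: gt_scale_def Poly_Mapping.map.rep_eq when_def)

global_interpretation gt: vector_space gt_scale
  by unfold_locales (auto intro!: poly_mapping_eqI simp: lookup_add algebra_simps)

definition gt_basis_vec :: "gt_array \<Rightarrow> gt_vec" where
  "gt_basis_vec \<xi> = Poly_Mapping.single \<xi> 1"

definition gt_space :: "nat \<Rightarrow> (nat \<Rightarrow> int) \<Rightarrow> gt_vec set" where
  "gt_space n m = {v. Poly_Mapping.keys v \<subseteq> gt_patterns n m}"

lemma gt_space_eq_span: "gt_space n m = gt.span (gt_basis_vec ` gt_patterns n m)"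
proof
  have "v = (\<Sum>\<xi>\<in>Poly_Mapping.keys v. gt_scale (Poly_Mapping.lookup v \<xi>) (gt_basis_vec \<xi>))" for v :: gt_vec
    by (rule poly_mapping_eqI)
      (auto simp: lookup_sum gt_basis_vec_def lookup_single when_def in_keys_iff if_distrib
        cong: if_cong)
  moreover have "(\<Sum>\<xi>\<in>Poly_Mapping.keys v. gt_scale (Poly_Mapping.lookup v \<xi>) (gt_basis_vec \<xi>))
      \<in> gt.span (gt_basis_vec ` gt_patterns n m)" if "v \<in> gt_space n m" for v
    using that by (intro gt.span_sum gt.span_scale gt.span_base) (auto simp: gt_space_def)
  ultimately show "gt_space n m \<subseteq> gt.span (gt_basis_vec ` gt_patterns n m)"
    by (metis subsetI)
next
  have "gt.subspace (gt_space n m)"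
  proof (rule gt.subspaceI)
    show "0 \<in> gt_space n m"
      by (simp add: gt_space_def)
    show "x + y \<in> gt_space n m" if "x \<in> gt_space n m" "y \<in> gt_space n m" for x y
      using that Poly_Mapping.keys_add[of x y] unfolding gt_space_def by blast
    show "gt_scale c x \<in> gt_space n m" if "x \<in> gt_space n m" for c x
      using that by (auto simp: gt_space_def in_keys_iff)
  qed
  then show "gt.span (gt_basis_vec ` gt_patterns n m) \<subseteq> gt_space n m"
    by (intro gt.span_minimal) (auto simp: gt_space_def gt_basis_vec_def)
qed

definition gt_linear_ext :: "(gt_array \<Rightarrow> gt_vec) \<Rightarrow> gt_vec \<Rightarrow> gt_vec" where
  "gt_linear_ext f v = (\<Sum>\<xi>\<in>Poly_Mapping.keys v. gt_scale (Poly_Mapping.lookup v \<xi>) (f \<xi>))"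

definition gt_l :: "gt_array \<Rightarrow> nat \<Rightarrow> nat \<Rightarrow> real" where
  "gt_l \<xi> p q = real_of_int (\<xi> p q) - real p"

definition gt_shift :: "gt_array \<Rightarrow> nat \<Rightarrow> nat \<Rightarrow> int \<Rightarrow> gt_array" where
  "gt_shift \<xi> j q d = \<xi>(j := (\<xi> j)(q := \<xi> j q + d))"

(* For a pattern \<xi>, the radicands below are nonnegative for every j over which gt_E, gt_F sum. *)
definition gt_a :: "nat \<Rightarrow> nat \<Rightarrow> gt_array \<Rightarrow> real" where
  "gt_a k j \<xi> = sqrt (-
     ((\<Prod>i=1..k. gt_l \<xi> i k - gt_l \<xi> j (k-1)) *
      (\<Prod>i=1..k-2. gt_l \<xi> i (k-2) - gt_l \<xi> j (k-1) - 1)) /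
     (\<Prod>i\<in>{1..k-1} - {j}. (gt_l \<xi> i (k-1) - gt_l \<xi> j (k-1)) *
                          (gt_l \<xi> i (k-1) - gt_l \<xi> j (k-1) - 1)))"

definition gt_b :: "nat \<Rightarrow> nat \<Rightarrow> gt_array \<Rightarrow> real" where
  "gt_b k j \<xi> = sqrt (-
     ((\<Prod>i=1..k. gt_l \<xi> i k - gt_l \<xi> j (k-1) + 1) *
      (\<Prod>i=1..k-2. gt_l \<xi> i (k-2) - gt_l \<xi> j (k-1))) /
     (\<Prod>i\<in>{1..k-1} - {j}. (gt_l \<xi> i (k-1) - gt_l \<xi> j (k-1) + 1) *
                          (gt_l \<xi> i (k-1) - gt_l \<xi> j (k-1))))"

text \<open>For \<open>2 \<le> k \<le> n\<close>, \<open>gt_E n m k\<close> is the action of the matrix unit \<open>e\<close> with index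
  \<open>(k-1, k)\<close> and \<open>gt_F n m k\<close> that of the one with index \<open>(k, k-1)\<close>.\<close>

definition gt_E :: "nat \<Rightarrow> (nat \<Rightarrow> int) \<Rightarrow> nat \<Rightarrow> gt_vec \<Rightarrow> gt_vec" where
  "gt_E n m k = gt_linear_ext (\<lambda>\<xi>.
     \<Sum>j | j \<in> {1..k-1} \<and> gt_shift \<xi> j (k-1) 1 \<in> gt_patterns n m.
       gt_scale (complex_of_real (gt_a k j \<xi>)) (gt_basis_vec (gt_shift \<xi> j (k-1) 1)))"

definition gt_F :: "nat \<Rightarrow> (nat \<Rightarrow> int) \<Rightarrow> nat \<Rightarrow> gt_vec \<Rightarrow> gt_vec" where
  "gt_F n m k = gt_linear_ext (\<lambda>\<xi>.
     \<Sum>j | j \<in> {1..k-1} \<and> gt_shift \<xi> j (k-1) (-1) \<in> gt_patterns n m.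
       gt_scale (complex_of_real (gt_b k j \<xi>)) (gt_basis_vec (gt_shift \<xi> j (k-1) (-1))))"

(* The letters k of the factors with index (k-1, k) of E^a, read from right to left:
   2,...,n, 2,...,n-1, ..., 2,3, 2. *)
definition gt_word :: "nat \<Rightarrow> nat list" where
  "gt_word n = concat (map (\<lambda>r. [2..<r+2]) (rev [1..<n]))"

lemma length_gt_word: "length (gt_word n) = n * (n - 1) div 2"
proof (induction n)
  case (Suc n)
  have "length (gt_word (Suc n)) = n + length (gt_word n)"
    by (cases n) (simp_all add: gt_word_def, arith)
  moreover have "Suc n * (Suc n - 1) = n * (n - 1) + n * 2"
    by (cases n) (simp_all add: algebra_simps)
  ultimately show ?case using Suc by simp
qed (simp add: gt_word_def)

fun gt_max_exponents :: "nat \<Rightarrow> (nat \<Rightarrow> int) \<Rightarrow> nat list \<Rightarrow> gt_vec \<Rightarrow> nat list" where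
  "gt_max_exponents n m [] v = []"
| "gt_max_exponents n m (k # ks) v =
     (let e = (GREATEST e. (gt_E n m k ^^ e) v \<noteq> 0)
      in e # gt_max_exponents n m ks ((gt_E n m k ^^ e) v))"

definition gt_exponent :: "nat \<Rightarrow> (nat \<Rightarrow> int) \<Rightarrow> gt_array \<Rightarrow> nat list" where
  "gt_exponent n m \<xi> = gt_max_exponents n m (gt_word n) (gt_basis_vec \<xi>)"

lemma length_gt_exponent: "length (gt_exponent n m \<xi>) = n * (n - 1) div 2"
proof -
  have "length (gt_max_exponents n m ks v) = length ks" for ks v
    by (induction ks arbitrary: v) (simp_all add: Let_def)
  then show ?thesis by (simp add: gt_exponent_def length_gt_word)
qed

(* foldr puts the first letter outermost, i.e. leftmost in the operator product. *)
definition gt_F_monomial :: "nat \<Rightarrow> (nat \<Rightarrow> int) \<Rightarrow> nat list \<Rightarrow> gt_vec \<Rightarrow> gt_vec" where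
  "gt_F_monomial n m a = foldr (\<lambda>(k, e) v. (gt_F n m k ^^ e) v) (zip (gt_word n) a)"

end

theory Submission imports Defs "HOL-Library.List_Lexorder" begin

text \<open>With respect to the pairing that makes the patterns orthonormal, each lowering operator is the
  transpose of the corresponding raising operator, so the coefficient of a pattern \<open>\<eta>\<close> in
  \<open>F\<^sup>a \<beta>\<close> is the coefficient of \<open>\<beta>\<close> in \<open>E\<^sup>a \<eta>\<close>.
  As the matrix coefficients are positive, applying the raising operator of row \<open>q\<close> maximally
  copies the entries of row \<open>q + 1\<close> into row \<open>q\<close>; along the word this moves
  every row up one step at a time until \<open>\<beta>\<close> is reached. If \<open>E\<^sup>a \<eta> \<noteq> 0\<close>,
  then \<open>a\<close> is lexicographically at most the exponent vector of \<open>\<eta>\<close>, so the matrix of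
  coefficients is triangular with nonzero diagonal, once exponent vectors are known to separate
  patterns. They do: the exponents are the differences of the sums of the first \<open>k\<close> entries of
  adjacent rows, and the top row is fixed.\<close>

section \<open>Interlacing inequalities and finiteness of the set of patterns\<close>

lemma mem_gt_patterns_iff:
  "\<xi> \<in> gt_patterns n m \<longleftrightarrow>
     (\<forall>i. 1 \<le> i \<and> i \<le> n \<longrightarrow> \<xi> i n = m i) \<and>
     (\<forall>i q. 1 \<le> i \<and> i \<le> q \<and> q < n \<longrightarrow> \<xi> i q \<le> \<xi> i (Suc q) \<and> \<xi> (Suc i) (Suc q) \<le> \<xi> i q) \<and>
     (\<forall>i q. \<not> (1 \<le> i \<and> i \<le> q \<and> q \<le> n) \<longrightarrow> \<xi> i q = 0)"
  (is "_ = (?A \<and> ?B \<and> ?C)")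
proof -
  have "?B \<longleftrightarrow> (\<forall>k\<in>{2..n}. \<forall>i\<in>{1..k-1}. \<xi> i k \<ge> \<xi> i (k-1) \<and> \<xi> i (k-1) \<ge> \<xi> (i+1) k)"
    (is "_ = ?B'")
  proof
    assume B: ?B
    show ?B'
    proof (intro ballI)
      fix k i assume "k \<in> {2..n}" "i \<in> {1..k-1}"
      then show "\<xi> i k \<ge> \<xi> i (k-1) \<and> \<xi> i (k-1) \<ge> \<xi> (i+1) k"
        using B[rule_format, of i "k - 1"] by (cases k) auto
    qed
  next
    assume B: ?B'
    show ?B
    proof (intro allI impI)
      fix i q assume "1 \<le> i \<and> i \<le> q \<and> q < n"
      then show "\<xi> i q \<le> \<xi> i (Suc q) \<and> \<xi> (Suc i) (Suc q) \<le> \<xi> i q"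
        using B[rule_format, of "Suc q" i] by simp
    qed
  qed
  then show ?thesis
    unfolding gt_patterns_def by auto
qed

lemma gt_pattern_top: "\<xi> \<in> gt_patterns n m \<Longrightarrow> 1 \<le> i \<Longrightarrow> i \<le> n \<Longrightarrow> \<xi> i n = m i"
  and gt_pattern_le: "\<xi> \<in> gt_patterns n m \<Longrightarrow> 1 \<le> i \<Longrightarrow> i \<le> q \<Longrightarrow> q < n \<Longrightarrow> \<xi> i q \<le> \<xi> i (Suc q)"
  and gt_pattern_ge: "\<xi> \<in> gt_patterns n m \<Longrightarrow> 1 \<le> i \<Longrightarrow> i \<le> q \<Longrightarrow> q < n \<Longrightarrow> \<xi> (Suc i) (Suc q) \<le> \<xi> i q"
  and gt_pattern_zero: "\<xi> \<in> gt_patterns n m \<Longrightarrow> \<not> (1 \<le> i \<and> i \<le> q \<and> q \<le> n) \<Longrightarrow> \<xi> i q = 0"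
  unfolding mem_gt_patterns_iff by blast+

text \<open>Neighbours in row \<open>q\<close> are separated by the entry
  \<open>\<xi> i (q - 1)\<close> of the next shorter row.\<close>

lemma gt_pattern_row_step:
  assumes "\<xi> \<in> gt_patterns n m" "1 \<le> i" "Suc i \<le> q" "q \<le> n"
  shows "\<xi> (Suc i) q \<le> \<xi> i q"
  using gt_pattern_le[OF assms(1,2), of "q - 1"] gt_pattern_ge[OF assms(1,2), of "q - 1"] assms(3,4)
  by (cases q) auto

lemma gt_pattern_row_antimono:
  assumes "\<xi> \<in> gt_patterns n m" "1 \<le> i" "i \<le> j" "j \<le> q" "q \<le> n"
  shows "\<xi> j q \<le> \<xi> i q"
  using assms(3,4)
proof (induction j rule: dec_induct)
  case (step j)
  then show ?case
    using gt_pattern_row_step[OF assms(1), of j q] assms(2,5) by simp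
qed simp

text \<open>Interlacing confines every entry to the range of the top row; the induction descends
  from row \<open>n\<close>, with \<open>d\<close> the distance from it.\<close>

lemma finite_gt_patterns: "finite (gt_patterns n m)"
proof -
  define I where "I = {Min (m ` {1..n})..Max (m ` {1..n})}"
  define G where "G = {g :: nat \<Rightarrow> int. \<forall>q. (q \<in> {1..n} \<longrightarrow> g q \<in> insert 0 I) \<and> (q \<notin> {1..n} \<longrightarrow> g q = 0)}"
  have "finite G"
    unfolding G_def I_def by (rule finite_set_of_finite_funs) auto
  then have "finite {\<xi>. \<forall>i. (i \<in> {1..n} \<longrightarrow> \<xi> i \<in> G) \<and> (i \<notin> {1..n} \<longrightarrow> \<xi> i = (\<lambda>_. 0))}"
    by (rule finite_set_of_finite_funs[rotated]) auto
  moreover have "\<xi> i \<in> G" if "\<xi> \<in> gt_patterns n m" for \<xi> i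
  proof -
    have "\<xi> i (n - d) \<in> I" if "1 \<le> i" "i \<le> n - d" for i d
      using that
    proof (induction d arbitrary: i)
      case 0
      then show ?case
        using gt_pattern_top[OF \<open>\<xi> \<in> gt_patterns n m\<close>, of i] by (simp add: I_def)
    next
      case (Suc d)
      have "Suc (n - Suc d) = n - d" using Suc.prems by simp
      then show ?case
        using Suc.IH[of i] Suc.IH[of "Suc i"] Suc.prems
          gt_pattern_le[OF \<open>\<xi> \<in> gt_patterns n m\<close>, of i "n - Suc d"]
          gt_pattern_ge[OF \<open>\<xi> \<in> gt_patterns n m\<close>, of i "n - Suc d"]
        by (simp add: I_def)
    qed
    then have "\<xi> i q \<in> I" if "1 \<le> i" "i \<le> q" "q \<le> n" for q
      using that by (metis diff_diff_cancel)
    then show ?thesis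
      using gt_pattern_zero[OF that] unfolding G_def by (auto; blast)
  qed
  ultimately show ?thesis
    by (elim finite_subset[rotated]) (auto intro!: gt_pattern_zero ext)
qed

subsection \<open>Linear operators\<close>

lemma gt_linear_ext_eq_sum:
  assumes "finite A" "Poly_Mapping.keys v \<subseteq> A"
  shows "gt_linear_ext f v = (\<Sum>\<xi>\<in>A. gt_scale (Poly_Mapping.lookup v \<xi>) (f \<xi>))"
  unfolding gt_linear_ext_def
  by (rule sum.mono_neutral_left) (use assms in \<open>auto simp: in_keys_iff\<close>)

lemma linear_gt_linear_ext: "Vector_Spaces.linear gt_scale gt_scale (gt_linear_ext f)"
proof unfold_locales
  fix v w :: gt_vec and c :: complex
  let ?A = "Poly_Mapping.keys v \<union> Poly_Mapping.keys w"
  have "Poly_Mapping.keys (v + w) \<subseteq> ?A" "Poly_Mapping.keys (gt_scale c v) \<subseteq> ?A"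
    using Poly_Mapping.keys_add[of v w] by (auto simp: in_keys_iff)
  then show "gt_linear_ext f (v + w) = gt_linear_ext f v + gt_linear_ext f w"
    and "gt_linear_ext f (gt_scale c v) = gt_scale c (gt_linear_ext f v)"
    by (simp_all add: gt_linear_ext_eq_sum[where A = ?A] lookup_add gt.scale_left_distrib
        sum.distrib gt.scale_sum_right)
qed

lemma linear_gt_E: "Vector_Spaces.linear gt_scale gt_scale (gt_E n m k)"
  unfolding gt_E_def by (rule linear_gt_linear_ext)

lemma linear_gt_E_power: "Vector_Spaces.linear gt_scale gt_scale (gt_E n m k ^^ e)"
proof (induction e)
  case 0
  show ?case
    using gt.linear_id by (simp add: id_def)
next
  case (Suc e)
  show ?case
    unfolding funpow.simps by (rule Vector_Spaces.linear_compose[OF Suc linear_gt_E])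
qed

interpretation gt_E_power: Vector_Spaces.linear gt_scale gt_scale "gt_E n m k ^^ e" for n m k e
  by (rule linear_gt_E_power)

lemma gt_linear_ext_basis_vec: "gt_linear_ext f (gt_basis_vec \<xi>) = f \<xi>"
  by (simp add: gt_linear_ext_def gt_basis_vec_def)

lemma gt_scale_basis_vec_neq_0: "c \<noteq> 0 \<Longrightarrow> gt_scale c (gt_basis_vec \<xi>) \<noteq> 0"
  by (metis gt.scale_eq_0_iff gt_basis_vec_def one_neq_zero single_zero lookup_single_eq lookup_zero)

lemma gt_E_basis_vec:
  "gt_E n m (Suc q) (gt_basis_vec \<xi>) =
     (\<Sum>j | j \<in> {1..q} \<and> gt_shift \<xi> j q 1 \<in> gt_patterns n m.
       gt_scale (complex_of_real (gt_a (Suc q) j \<xi>)) (gt_basis_vec (gt_shift \<xi> j q 1)))"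
  by (simp add: gt_E_def gt_linear_ext_basis_vec)

lemma gt_linear_ext_in_gt_space:
  assumes "\<And>\<xi>. f \<xi> \<in> gt_space n m"
  shows "gt_linear_ext f v \<in> gt_space n m"
  unfolding gt_linear_ext_def gt_space_eq_span
  using assms by (intro gt.span_sum gt.span_scale) (simp add: gt_space_eq_span)

lemma gt_sum_in_gt_space:
  "(\<And>j. j \<in> J \<Longrightarrow> \<eta> j \<in> gt_patterns n m) \<Longrightarrow>
    (\<Sum>j\<in>J. gt_scale (c j) (gt_basis_vec (\<eta> j))) \<in> gt_space n m"
  unfolding gt_space_eq_span by (intro gt.span_sum gt.span_scale gt.span_base) blast

lemma gt_E_in_gt_space: "gt_E n m k v \<in> gt_space n m"
  and gt_F_in_gt_space: "gt_F n m k v \<in> gt_space n m"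
  unfolding gt_E_def gt_F_def
  by (rule gt_linear_ext_in_gt_space, rule gt_sum_in_gt_space, blast)+

subsection \<open>Positivity of the coefficients\<close>

text \<open>Serves the two numerator products in \<open>gt_a\<close>, whose factors change sign
  once, at a position dictated by interlacing.\<close>

lemma prod_sign_change:
  fixes f :: "nat \<Rightarrow> real"
  assumes "\<And>i. i \<in> {1..j} \<Longrightarrow> 0 < f i" "\<And>i. i \<in> {j<..k} \<Longrightarrow> f i < 0" "j \<le> k"
  shows "0 < (-1) ^ (k - j) * (\<Prod>i=1..k. f i)"
  using assms(3,2)
proof (induction k rule: dec_induct)
  case base
  then show ?case by (auto intro!: prod_pos assms(1))
next
  case (step k)
  have "0 < - f (Suc k)" "0 < (-1) ^ (k - j) * (\<Prod>i=1..k. f i)"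
    using step by auto
  then have "0 < (- f (Suc k)) * ((-1) ^ (k - j) * (\<Prod>i=1..k. f i))"
    by (rule mult_pos_pos)
  with step.hyps show ?case by (simp add: Suc_diff_le mult_ac)
qed

text \<open>The numerator products have \<open>q + 1 - j\<close> and \<open>q - j\<close> negative
  factors, the denominator is positive, and the leading minus sign absorbs the odd total. The strict
  inequalities at position \<open>j\<close> come from the shifted array being a pattern.\<close>

lemma gt_a_pos:
  assumes "\<xi> \<in> gt_patterns n m" "gt_shift \<xi> j q 1 \<in> gt_patterns n m" "1 \<le> j" "j \<le> q" "q < n"
  shows "0 < gt_a (Suc q) j \<xi>"
proof -
  note antimono = gt_pattern_row_antimono[OF assms(1)]
  define x where "x = gt_l \<xi> j q"
  have top: "\<xi> j q + 1 \<le> \<xi> j (Suc q)"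
    using gt_pattern_le[OF assms(2,3), of q] assms(4,5) by (simp add: gt_shift_def)
  have bot: "\<xi> j q + 1 \<le> \<xi> i (q - 1)" if "1 \<le> i" "i < j" for i
  proof -
    have "\<xi> j q + 1 \<le> \<xi> (j - 1) (q - 1)"
      using gt_pattern_ge[OF assms(2), of "j - 1" "q - 1"] that assms(4,5)
      by (cases j) (simp_all add: gt_shift_def)
    also have "\<dots> \<le> \<xi> i (q - 1)"
      using antimono[of i "j - 1" "q - 1"] that assms(4,5) by simp
    finally show ?thesis .
  qed
  have num1: "0 < (-1) ^ (Suc q - j) * (\<Prod>i=1..Suc q. gt_l \<xi> i (Suc q) - x)"
  proof (rule prod_sign_change)
    fix i assume "i \<in> {1..j}"
    then show "0 < gt_l \<xi> i (Suc q) - x"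
      using antimono[of i j "Suc q"] top assms(4,5) by (simp add: gt_l_def x_def)
  next
    fix i assume "i \<in> {j<..Suc q}"
    then show "gt_l \<xi> i (Suc q) - x < 0"
      using antimono[of "Suc j" i "Suc q"] gt_pattern_ge[OF assms(1,3,4,5)] assms(3,4,5)
      by (simp add: gt_l_def x_def)
  qed (use assms in simp)
  have num2: "0 < (-1) ^ (q - 1 - (j - 1)) * (\<Prod>i=1..q-1. gt_l \<xi> i (q - 1) - x - 1)"
  proof (rule prod_sign_change)
    fix i assume "i \<in> {1..j-1}"
    then have "1 \<le> i" "i < j" by auto
    then show "0 < gt_l \<xi> i (q - 1) - x - 1"
      using bot[of i] by (simp add: gt_l_def x_def)
  next
    fix i assume "i \<in> {j-1<..q-1}"
    then have i: "j \<le> i" "i \<le> q - 1" by auto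
    with assms(3-5) have "\<xi> i (q - 1) \<le> \<xi> j (q - 1)" "\<xi> j (q - 1) \<le> \<xi> j q"
      using antimono[of j i "q - 1"] gt_pattern_le[OF assms(1,3), of "q - 1"] by auto
    with i show "gt_l \<xi> i (q - 1) - x - 1 < 0"
      by (simp add: gt_l_def x_def)
  qed (use assms in simp)
  \<comment> \<open>Both factors of each pair have the same sign: the difference of the
    \<open>l\<close> values is at least 2 for \<open>i < j\<close> and at most -1 for
    \<open>i > j\<close>.\<close>
  have den: "0 < (\<Prod>i\<in>{1..q} - {j}. (gt_l \<xi> i q - x) * (gt_l \<xi> i q - x - 1))"
  proof (rule prod_pos)
    fix i assume i: "i \<in> {1..q} - {j}"
    show "0 < (gt_l \<xi> i q - x) * (gt_l \<xi> i q - x - 1)"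
    proof (cases "i < j")
      case True
      then have "\<xi> j q + 1 \<le> \<xi> i q"
        using bot[of i] gt_pattern_le[OF assms(1), of i "q - 1"] i assms(4,5) by (cases q) auto
      with True show ?thesis by (simp add: gt_l_def x_def)
    next
      case False
      then show ?thesis
        using antimono[of j i q] i assms(3,5) by (intro mult_neg_neg) (simp_all add: gt_l_def x_def)
    qed
  qed
  have "Suc q - j = Suc (q - 1 - (j - 1))" using assms by simp
  then have "0 < - ((\<Prod>i=1..Suc q. gt_l \<xi> i (Suc q) - x) * (\<Prod>i=1..q-1. gt_l \<xi> i (q - 1) - x - 1))"
    using mult_pos_pos[OF num1 num2]
    by (simp add: mult_ac flip: power_add mult_2 power_mult)
  from divide_pos_pos[OF this den] show ?thesis
    by (simp add: gt_a_def x_def)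
qed

subsection \<open>The lowering operators are the transposes of the raising operators\<close>

text \<open>Adding 1 to \<open>l\<close> at \<open>(j, q)\<close> turns the radicand of
  \<open>gt_b\<close> into that of \<open>gt_a\<close>, so a step up and the step back down carry
  the same coefficient.\<close>

lemma gt_b_shift:
  assumes "1 \<le> j" "j \<le> q"
  shows "gt_b (Suc q) j (gt_shift \<xi> j q 1) = gt_a (Suc q) j \<xi>"
proof -
  let ?\<eta> = "gt_shift \<xi> j q 1"
  have "q - 1 \<noteq> q"
    using assms by simp
  have j: "gt_l ?\<eta> j q = gt_l \<xi> j q + 1"
    and other: "\<And>i p. i \<noteq> j \<or> p \<noteq> q \<Longrightarrow> gt_l ?\<eta> i p = gt_l \<xi> i p"
    by (auto simp: gt_l_def gt_shift_def)
  have "(\<Prod>i=1..Suc q. gt_l ?\<eta> i (Suc q) - gt_l ?\<eta> j q + 1) = (\<Prod>i=1..Suc q. gt_l \<xi> i (Suc q) - gt_l \<xi> j q)"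
    by (intro prod.cong) (simp_all add: j other)
  moreover have "(\<Prod>i=1..q-1. gt_l ?\<eta> i (q-1) - gt_l ?\<eta> j q) = (\<Prod>i=1..q-1. gt_l \<xi> i (q-1) - gt_l \<xi> j q - 1)"
    using \<open>q - 1 \<noteq> q\<close> by (intro prod.cong) (simp_all add: j other)
  moreover have "(\<Prod>i\<in>{1..q} - {j}. (gt_l ?\<eta> i q - gt_l ?\<eta> j q + 1) * (gt_l ?\<eta> i q - gt_l ?\<eta> j q)) =
      (\<Prod>i\<in>{1..q} - {j}. (gt_l \<xi> i q - gt_l \<xi> j q) * (gt_l \<xi> i q - gt_l \<xi> j q - 1))"
    by (intro prod.cong) (simp_all add: j other)
  ultimately show ?thesis
    by (simp add: gt_a_def gt_b_def del: prod.cl_ivl_Suc)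
qed

lemma lookup_gt_F_basis_vec:
  assumes "\<xi> \<in> gt_patterns n m" "\<eta> \<in> gt_patterns n m"
  shows "Poly_Mapping.lookup (gt_F n m k (gt_basis_vec \<eta>)) \<xi> =
    Poly_Mapping.lookup (gt_E n m k (gt_basis_vec \<xi>)) \<eta>"
proof -
  have shift: "gt_shift \<eta> j q (-1) = \<xi> \<longleftrightarrow> gt_shift \<xi> j q 1 = \<eta>" for j q
    unfolding gt_shift_def fun_eq_iff fun_upd_apply by (smt (verit))
  have "Poly_Mapping.lookup (gt_F n m k (gt_basis_vec \<eta>)) \<xi> =
      (\<Sum>j\<in>{1..k-1}. if gt_shift \<eta> j (k-1) (-1) = \<xi> then complex_of_real (gt_b k j \<eta>) else 0)"
    using assms unfolding gt_F_def gt_linear_ext_basis_vec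
    by (auto simp: lookup_sum gt_basis_vec_def lookup_single when_def intro!: sum.mono_neutral_cong_left split: if_splits)
  also have "\<dots> = (\<Sum>j\<in>{1..k-1}. if gt_shift \<xi> j (k-1) 1 = \<eta> then complex_of_real (gt_a k j \<xi>) else 0)"
    unfolding shift using gt_b_shift[of _ "k - 1" \<xi>] by (intro sum.cong) auto
  also have "\<dots> = Poly_Mapping.lookup (gt_E n m k (gt_basis_vec \<xi>)) \<eta>"
    using assms unfolding gt_E_def gt_linear_ext_basis_vec
    by (auto simp: lookup_sum gt_basis_vec_def lookup_single when_def intro!: sum.mono_neutral_cong_right split: if_splits)
  finally show ?thesis .
qed

text \<open>Bilinear, without conjugation, so that the operators have transposes with no scalars
  conjugated.\<close>

definition gt_pairing :: "nat \<Rightarrow> (nat \<Rightarrow> int) \<Rightarrow> gt_vec \<Rightarrow> gt_vec \<Rightarrow> complex" where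
  "gt_pairing n m v w =
     (\<Sum>\<xi>\<in>gt_patterns n m. Poly_Mapping.lookup v \<xi> * Poly_Mapping.lookup w \<xi>)"

lemma gt_pairing_basis_vec:
  assumes "\<xi> \<in> gt_patterns n m"
  shows "gt_pairing n m v (gt_basis_vec \<xi>) = Poly_Mapping.lookup v \<xi>"
    and "gt_pairing n m (gt_basis_vec \<xi>) v = Poly_Mapping.lookup v \<xi>"
  using assms finite_gt_patterns[of n m]
  by (simp_all add: gt_pairing_def gt_basis_vec_def lookup_single when_def if_distrib if_distribR
      cong: if_cong)

lemma lookup_gt_linear_ext:
  assumes "v \<in> gt_space n m"
  shows "Poly_Mapping.lookup (gt_linear_ext f v) \<xi> =
    (\<Sum>\<eta>\<in>gt_patterns n m. Poly_Mapping.lookup v \<eta> * Poly_Mapping.lookup (f \<eta>) \<xi>)"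
  using assms finite_gt_patterns[of n m]
  by (subst gt_linear_ext_eq_sum[where A = "gt_patterns n m"]) (auto simp: gt_space_def lookup_sum)

lemma gt_pairing_gt_F:
  assumes "v \<in> gt_space n m" "w \<in> gt_space n m"
  shows "gt_pairing n m (gt_F n m k v) w = gt_pairing n m v (gt_E n m k w)"
proof -
  let ?P = "gt_patterns n m"
  have F: "Poly_Mapping.lookup (gt_F n m k v) \<xi> =
      (\<Sum>\<eta>\<in>?P. Poly_Mapping.lookup v \<eta> * Poly_Mapping.lookup (gt_F n m k (gt_basis_vec \<eta>)) \<xi>)" for \<xi>
    unfolding gt_F_def gt_linear_ext_basis_vec by (rule lookup_gt_linear_ext[OF assms(1)])
  have E: "Poly_Mapping.lookup (gt_E n m k w) \<eta> =
      (\<Sum>\<xi>\<in>?P. Poly_Mapping.lookup w \<xi> * Poly_Mapping.lookup (gt_E n m k (gt_basis_vec \<xi>)) \<eta>)" for \<eta>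
    unfolding gt_E_def gt_linear_ext_basis_vec by (rule lookup_gt_linear_ext[OF assms(2)])
  show ?thesis
    unfolding gt_pairing_def F E sum_distrib_left sum_distrib_right
    by (subst sum.swap) (intro sum.cong refl, simp add: lookup_gt_F_basis_vec)
qed

lemma gt_pairing_gt_F_power:
  assumes "v \<in> gt_space n m" "w \<in> gt_space n m"
  shows "gt_pairing n m ((gt_F n m k ^^ e) v) w = gt_pairing n m v ((gt_E n m k ^^ e) w)"
  using assms
proof (induction e arbitrary: v)
  case (Suc e)
  have "(gt_E n m k ^^ e) w \<in> gt_space n m"
    using Suc.prems(2) by (cases e) (simp_all add: gt_E_in_gt_space)
  then show ?case
    using Suc by (simp add: funpow_swap1[of "gt_F n m k" e v] gt_F_in_gt_space gt_pairing_gt_F)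
qed simp

abbreviation gt_word_F :: "nat \<Rightarrow> (nat \<Rightarrow> int) \<Rightarrow> (nat \<times> nat) list \<Rightarrow> gt_vec \<Rightarrow> gt_vec" where
  "gt_word_F n m \<equiv> foldr (\<lambda>(k, e) v. (gt_F n m k ^^ e) v)"

text \<open>\<open>fold\<close> applies the first letter first, whereas \<open>foldr\<close> in
  \<open>gt_word_F\<close> applies it last; one list thus encodes an operator product and its
  transpose.\<close>

abbreviation gt_word_E :: "nat \<Rightarrow> (nat \<Rightarrow> int) \<Rightarrow> (nat \<times> nat) list \<Rightarrow> gt_vec \<Rightarrow> gt_vec" where
  "gt_word_E n m \<equiv> fold (\<lambda>(k, e) v. (gt_E n m k ^^ e) v)"

lemma gt_word_F_in_gt_space: "v \<in> gt_space n m \<Longrightarrow> gt_word_F n m zs v \<in> gt_space n m"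
proof (induction zs)
  case (Cons z zs)
  then show ?case by (cases z; cases "snd z") (simp_all add: gt_F_in_gt_space)
qed simp

lemma gt_pairing_gt_word_F:
  assumes "v \<in> gt_space n m" "w \<in> gt_space n m"
  shows "gt_pairing n m (gt_word_F n m zs v) w = gt_pairing n m v (gt_word_E n m zs w)"
  using assms(2)
proof (induction zs arbitrary: w)
  case (Cons z zs)
  obtain k e where z: "z = (k, e)" by fastforce
  have "(gt_E n m k ^^ e) w \<in> gt_space n m"
    using Cons.prems by (cases e) (simp_all add: gt_E_in_gt_space)
  then show ?case
    using Cons gt_word_F_in_gt_space[OF assms(1)] by (simp add: z gt_pairing_gt_F_power)
qed simp

subsection \<open>Maximal powers of a raising operator\<close>

text \<open>The effect of the maximal power of the raising operator with index \<open>(q, q + 1)\<close>, and its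
  exponent.\<close>

definition gt_raise :: "nat \<Rightarrow> gt_array \<Rightarrow> gt_array" where
  "gt_raise q \<xi> = (\<lambda>i p. if p = q \<and> 1 \<le> i \<and> i \<le> q then \<xi> i (Suc q) else \<xi> i p)"

definition gt_gap :: "nat \<Rightarrow> gt_array \<Rightarrow> int" where
  "gt_gap q \<xi> = (\<Sum>i=1..q. \<xi> i (Suc q) - \<xi> i q)"

lemma gt_gap_nonneg: "\<xi> \<in> gt_patterns n m \<Longrightarrow> q < n \<Longrightarrow> 0 \<le> gt_gap q \<xi>"
  unfolding gt_gap_def by (intro sum_nonneg) (simp add: gt_pattern_le)

lemma gt_raise_shift: "gt_raise q (gt_shift \<xi> j q d) = gt_raise q \<xi>" if "1 \<le> j" "j \<le> q"
  using that by (auto simp: gt_raise_def gt_shift_def fun_eq_iff)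

lemma gt_gap_shift:
  assumes "1 \<le> j" "j \<le> q"
  shows "gt_gap q (gt_shift \<xi> j q 1) = gt_gap q \<xi> - 1"
proof -
  have "gt_gap q (gt_shift \<xi> j q 1) =
      (\<Sum>i=1..q. (\<xi> i (Suc q) - \<xi> i q) - (if i = j then 1 else 0))"
    unfolding gt_gap_def by (intro sum.cong) (auto simp: gt_shift_def)
  then show ?thesis
    using assms by (simp add: sum_subtractf gt_gap_def)
qed

text \<open>The delicate bound, for \<open>j > 1\<close>, is
  \<open>\<xi> j q + 1 \<le> \<xi> (j - 1) (q - 1)\<close>. It holds because the raised array is a
  pattern, so already \<open>\<xi> j (q + 1)\<close> is at most that entry.\<close>

lemma gt_shift_in_gt_patterns:
  assumes "\<xi> \<in> gt_patterns n m" "gt_raise q \<xi> \<in> gt_patterns n m"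
    and "1 \<le> j" "j \<le> q" "q < n" "\<xi> j q < \<xi> j (Suc q)"
  shows "gt_shift \<xi> j q 1 \<in> gt_patterns n m"
  unfolding mem_gt_patterns_iff
proof (intro conjI allI impI)
  fix i assume "1 \<le> i \<and> i \<le> n"
  then show "gt_shift \<xi> j q 1 i n = m i"
    using gt_pattern_top[OF assms(1)] assms(5) by (auto simp: gt_shift_def)
next
  fix i p assume ip: "1 \<le> i \<and> i \<le> p \<and> p < n"
  show "gt_shift \<xi> j q 1 i p \<le> gt_shift \<xi> j q 1 i (Suc p)"
    using ip gt_pattern_le[OF assms(1), of i p] assms(6) by (auto simp: gt_shift_def)
  show "gt_shift \<xi> j q 1 (Suc i) (Suc p) \<le> gt_shift \<xi> j q 1 i p"
    using ip gt_pattern_ge[OF assms(1), of i p] gt_pattern_ge[OF assms(2), of i p] assms(4,6)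
    by (auto simp: gt_shift_def gt_raise_def split: if_splits)
next
  fix i p assume "\<not> (1 \<le> i \<and> i \<le> p \<and> p \<le> n)"
  then show "gt_shift \<xi> j q 1 i p = 0"
    using gt_pattern_zero[OF assms(1)] assms(3-5) by (auto simp: gt_shift_def)
qed

text \<open>Each admissible unit shift lowers the gap by one and preserves
  \<open>gt_raise q \<xi>\<close>. Hence all chains of \<open>d\<close> shifts end in the same
  array, and their positive coefficients cannot cancel.\<close>

lemma gt_E_power_gap:
  assumes "\<xi> \<in> gt_patterns n m" "gt_raise q \<xi> \<in> gt_patterns n m" "q < n" "gt_gap q \<xi> = int d"
  shows "(\<exists>c>0. (gt_E n m (Suc q) ^^ d) (gt_basis_vec \<xi>) =
      gt_scale (complex_of_real c) (gt_basis_vec (gt_raise q \<xi>))) \<and>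
    (gt_E n m (Suc q) ^^ Suc d) (gt_basis_vec \<xi>) = 0"
  using assms
proof (induction d arbitrary: \<xi>)
  case 0
  have "\<xi> i (Suc q) - \<xi> i q = 0" if "i \<in> {1..q}" for i
    using 0 that sum_nonneg_eq_0_iff[of "{1..q}" "\<lambda>i. \<xi> i (Suc q) - \<xi> i q"]
    by (auto simp: gt_gap_def gt_pattern_le)
  then have "gt_raise q \<xi> = \<xi>"
    by (auto simp: gt_raise_def fun_eq_iff)
  \<comment> \<open>A shifted pattern would have gap -1.\<close>
  moreover have "gt_shift \<xi> j q 1 \<notin> gt_patterns n m" if "j \<in> {1..q}" for j
    using gt_gap_nonneg[of "gt_shift \<xi> j q 1" n m q] gt_gap_shift[of j q \<xi>] 0 that by auto
  then have "{j. j \<in> {1..q} \<and> gt_shift \<xi> j q 1 \<in> gt_patterns n m} = {}"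
    by blast
  then have "gt_E n m (Suc q) (gt_basis_vec \<xi>) = 0"
    by (simp only: gt_E_basis_vec sum.empty)
  ultimately show ?case
    by (auto intro!: exI[of _ 1])
next
  case (Suc d)
  define J where "J = {j. j \<in> {1..q} \<and> gt_shift \<xi> j q 1 \<in> gt_patterns n m}"
  \<comment> \<open>The rightmost factor is split off, so that the induction hypothesis applies to
    the shifted patterns.\<close>
  have E: "(gt_E n m (Suc q) ^^ Suc e) (gt_basis_vec \<xi>) = (\<Sum>j\<in>J. gt_scale (complex_of_real (gt_a (Suc q) j \<xi>))
      ((gt_E n m (Suc q) ^^ e) (gt_basis_vec (gt_shift \<xi> j q 1))))" for e
    unfolding funpow_Suc_right comp_apply gt_E_basis_vec J_def[symmetric]
    by (simp add: gt_E_power.sum gt_E_power.scale)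
  have "\<forall>j\<in>J. (\<exists>c>0. (gt_E n m (Suc q) ^^ d) (gt_basis_vec (gt_shift \<xi> j q 1)) =
      gt_scale (complex_of_real c) (gt_basis_vec (gt_raise q \<xi>))) \<and>
    (gt_E n m (Suc q) ^^ Suc d) (gt_basis_vec (gt_shift \<xi> j q 1)) = 0" (is "\<forall>j\<in>J. ?P j")
  proof
    fix j assume "j \<in> J"
    then have j: "1 \<le> j" "j \<le> q" "gt_shift \<xi> j q 1 \<in> gt_patterns n m"
      by (auto simp: J_def)
    then show "?P j"
      using Suc.IH[of "gt_shift \<xi> j q 1"] Suc.prems
      unfolding gt_raise_shift[OF j(1,2)] gt_gap_shift[OF j(1,2)] by simp
  qed
  then obtain c where c: "\<And>j. j \<in> J \<Longrightarrow> 0 < c j"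
      "\<And>j. j \<in> J \<Longrightarrow> (gt_E n m (Suc q) ^^ d) (gt_basis_vec (gt_shift \<xi> j q 1)) =
         gt_scale (complex_of_real (c j)) (gt_basis_vec (gt_raise q \<xi>))"
    and zero: "\<And>j. j \<in> J \<Longrightarrow> (gt_E n m (Suc q) ^^ Suc d) (gt_basis_vec (gt_shift \<xi> j q 1)) = 0"
    by metis
  have "0 < gt_a (Suc q) j \<xi>" if "j \<in> J" for j
    using that Suc.prems by (intro gt_a_pos) (auto simp: J_def)
  \<comment> \<open>A positive gap forces some entry of row \<open>q\<close> strictly below the one
    above it; that entry can be shifted.\<close>
  moreover have "J \<noteq> {}"
  proof -
    have "\<exists>j\<in>{1..q}. 0 < \<xi> j (Suc q) - \<xi> j q"
      using Suc.prems(4) sum_nonpos[of "{1..q}" "\<lambda>i. \<xi> i (Suc q) - \<xi> i q"]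
      by (force simp: gt_gap_def not_less)
    then show ?thesis
      using gt_shift_in_gt_patterns[OF Suc.prems(1,2) _ _ Suc.prems(3)] by (auto simp: J_def)
  qed
  ultimately have "0 < (\<Sum>j\<in>J. gt_a (Suc q) j \<xi> * c j)"
    using c(1) by (intro sum_pos) (simp_all add: J_def)
  moreover have "(gt_E n m (Suc q) ^^ Suc d) (gt_basis_vec \<xi>) =
      gt_scale (complex_of_real (\<Sum>j\<in>J. gt_a (Suc q) j \<xi> * c j)) (gt_basis_vec (gt_raise q \<xi>))"
    unfolding E by (simp add: c(2) gt.scale_sum_left)
  moreover have "(gt_E n m (Suc q) ^^ Suc (Suc d)) (gt_basis_vec \<xi>) = 0"
    unfolding E[of "Suc d"] using zero by simp
  ultimately show ?case by blast
qed

lemma gt_E_power_eq_0_mono: "(gt_E n m k ^^ d) v = 0 \<Longrightarrow> d \<le> e \<Longrightarrow> (gt_E n m k ^^ e) v = 0"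
  using gt_E_power.zero[of "e - d" n m k] by (metis comp_apply funpow_add le_add_diff_inverse2)

context
  fixes n :: nat and m :: "nat \<Rightarrow> int" and q :: nat and \<xi> :: gt_array and c :: complex
  assumes \<xi>: "\<xi> \<in> gt_patterns n m" "gt_raise q \<xi> \<in> gt_patterns n m" "q < n" and c: "c \<noteq> 0"
begin

text \<open>The scalar is carried along because each further letter of the word acts on a nonzero
  multiple of a pattern.\<close>

lemma gt_E_power_gap_scaled:
  "\<exists>c'. c' \<noteq> 0 \<and> (gt_E n m (Suc q) ^^ nat (gt_gap q \<xi>)) (gt_scale c (gt_basis_vec \<xi>)) =
     gt_scale c' (gt_basis_vec (gt_raise q \<xi>))"
proof -
  have "gt_gap q \<xi> = int (nat (gt_gap q \<xi>))"
    using gt_gap_nonneg \<xi> by simp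
  from gt_E_power_gap[OF \<xi> this] obtain r where "0 < r"
    "(gt_E n m (Suc q) ^^ nat (gt_gap q \<xi>)) (gt_basis_vec \<xi>) =
       gt_scale (complex_of_real r) (gt_basis_vec (gt_raise q \<xi>))"
    by blast
  then show ?thesis
    using c by (intro exI[of _ "c * complex_of_real r"]) (simp add: gt_E_power.scale)
qed

lemma gt_E_power_neq_0_iff:
  "(gt_E n m (Suc q) ^^ e) (gt_scale c (gt_basis_vec \<xi>)) \<noteq> 0 \<longleftrightarrow> e \<le> nat (gt_gap q \<xi>)"
proof -
  have "gt_gap q \<xi> = int (nat (gt_gap q \<xi>))"
    using gt_gap_nonneg \<xi> by simp
  from gt_E_power_gap[OF \<xi> this]
  have "(gt_E n m (Suc q) ^^ Suc (nat (gt_gap q \<xi>))) (gt_scale c (gt_basis_vec \<xi>)) = 0"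
    unfolding gt_E_power.scale by simp
  then show ?thesis
    using gt_E_power_eq_0_mono gt_E_power_gap_scaled gt_scale_basis_vec_neq_0
    by (metis not_less_eq_eq)
qed

lemma Greatest_gt_E_power:
  "(GREATEST e. (gt_E n m (Suc q) ^^ e) (gt_scale c (gt_basis_vec \<xi>)) \<noteq> 0) = nat (gt_gap q \<xi>)"
  unfolding gt_E_power_neq_0_iff by (rule Greatest_equality) auto

end

subsection \<open>Triangularity\<close>

text \<open>\<open>gt_climb n m ks \<xi> as \<zeta>\<close>: applying the raising operators with letters \<open>ks\<close>, each
  maximally, leads from \<open>\<xi>\<close> to \<open>\<zeta>\<close> with exponents \<open>as\<close>.\<close>

inductive gt_climb :: "nat \<Rightarrow> (nat \<Rightarrow> int) \<Rightarrow> nat list \<Rightarrow> gt_array \<Rightarrow> nat list \<Rightarrow> gt_array \<Rightarrow> bool"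
  for n m where
  gt_climb_Nil: "gt_climb n m [] \<xi> [] \<xi>"
| gt_climb_Cons: "\<lbrakk>\<xi> \<in> gt_patterns n m; gt_raise q \<xi> \<in> gt_patterns n m; q < n;
    gt_climb n m ks (gt_raise q \<xi>) as \<zeta>\<rbrakk> \<Longrightarrow>
    gt_climb n m (Suc q # ks) \<xi> (nat (gt_gap q \<xi>) # as) \<zeta>"

text \<open>Links climbs to the greedy definition: at each letter the last nonvanishing power is the
  gap, whatever the nonzero scalar.\<close>

lemma gt_climb_max_exponents:
  assumes "gt_climb n m ks \<xi> as \<zeta>" "c \<noteq> 0"
  shows "gt_max_exponents n m ks (gt_scale c (gt_basis_vec \<xi>)) = as"
  using assms
proof (induction arbitrary: c)
  case (gt_climb_Cons \<xi> q ks as \<zeta>)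
  show ?case
    using gt_E_power_gap_scaled[OF gt_climb_Cons.hyps(1-3) gt_climb_Cons.prems] gt_climb_Cons.IH
    by (auto simp: Let_def Greatest_gt_E_power[OF gt_climb_Cons.hyps(1-3) gt_climb_Cons.prems])
qed simp

lemma gt_climb_word_E:
  assumes "gt_climb n m ks \<xi> as \<zeta>" "c \<noteq> 0"
  shows "\<exists>c'. c' \<noteq> 0 \<and>
    gt_word_E n m (zip ks as) (gt_scale c (gt_basis_vec \<xi>)) = gt_scale c' (gt_basis_vec \<zeta>)"
  using assms
proof (induction arbitrary: c)
  case (gt_climb_Cons \<xi> q ks as \<zeta>)
  show ?case
    using gt_E_power_gap_scaled[OF gt_climb_Cons.hyps(1-3) gt_climb_Cons.prems] gt_climb_Cons.IH
    by auto
qed auto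

lemma gt_word_E_zero: "gt_word_E n m zs 0 = 0"
  by (induction zs) (auto simp: gt_E_power.zero)

text \<open>As long as \<open>bs\<close> agrees with \<open>as\<close>, the vector is a nonzero
  multiple of the pattern reached by the climb. At the first disagreement an exponent above the gap
  would annihilate it, so that of \<open>bs\<close> is smaller, which decides the lexicographic
  order.\<close>

lemma gt_climb_lex_max:
  assumes "gt_climb n m ks \<xi> as \<zeta>" "c \<noteq> 0" "length bs = length ks"
    and "gt_word_E n m (zip ks bs) (gt_scale c (gt_basis_vec \<xi>)) \<noteq> 0"
  shows "bs \<le> as"
  using assms
proof (induction arbitrary: c bs)
  case (gt_climb_Cons \<xi> q ks as \<zeta>)
  note power = gt_E_power_neq_0_iff[OF gt_climb_Cons.hyps(1-3) gt_climb_Cons.prems(1)]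
    gt_E_power_gap_scaled[OF gt_climb_Cons.hyps(1-3) gt_climb_Cons.prems(1)]
  obtain e bs' where bs: "bs = e # bs'" "length bs' = length ks"
    using gt_climb_Cons.prems(2) by (cases bs) auto
  have "(gt_E n m (Suc q) ^^ e) (gt_scale c (gt_basis_vec \<xi>)) \<noteq> 0"
    using gt_climb_Cons.prems(3) gt_word_E_zero by (auto simp: bs)
  then have "e \<le> nat (gt_gap q \<xi>)"
    using power(1) by blast
  moreover have "bs' \<le> as" if "e = nat (gt_gap q \<xi>)"
    using power(2) gt_climb_Cons.prems(3) gt_climb_Cons.IH[OF _ bs(2)] that by (auto simp: bs)
  ultimately show ?case
    by (auto simp: bs)
qed simp

subsection \<open>The climb from a pattern to the top pattern\<close>

text \<open>The array reached from \<open>\<xi>\<close> after \<open>s\<close> blocks of the word and the raising of the rows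
  below \<open>k\<close> in the next block.\<close>

definition gt_climb_state :: "nat \<Rightarrow> gt_array \<Rightarrow> nat \<Rightarrow> nat \<Rightarrow> gt_array" where
  "gt_climb_state n \<xi> s k = (\<lambda>i q. if 1 \<le> i \<and> i \<le> q \<and> q \<le> n
     then \<xi> i (min n (if q < k then q + s + 1 else q + s)) else 0)"

text \<open>Row \<open>q\<close> of the state is an initial segment of row \<open>c q\<close> of
  \<open>\<xi>\<close>, and \<open>c\<close> grows by 0 or 1 from one row to the next. Growth 1
  gives interlacing; growth 0 reduces it to monotonicity within a row.\<close>

lemma gt_climb_state_in_gt_patterns:
  assumes "\<xi> \<in> gt_patterns n m"
  shows "gt_climb_state n \<xi> s k \<in> gt_patterns n m"
proof -
  define c where "c q = min n (if q < k then q + s + 1 else q + s)" for q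
  have state: "gt_climb_state n \<xi> s k i q = (if 1 \<le> i \<and> i \<le> q \<and> q \<le> n then \<xi> i (c q) else 0)" for i q
    by (simp add: gt_climb_state_def c_def)
  have "\<xi> i (c q) \<le> \<xi> i (c (Suc q)) \<and> \<xi> (Suc i) (c (Suc q)) \<le> \<xi> i (c q)"
    if "1 \<le> i" "i \<le> q" "q < n" for i q
  proof (cases "c (Suc q) = c q")
    case True
    then have "Suc i \<le> c q" "c q \<le> n"
      using that by (auto simp: c_def split: if_splits)
    then show ?thesis
      using True gt_pattern_row_step[OF assms] that by simp
  next
    case False
    then have "c (Suc q) = Suc (c q)" "i \<le> c q" "c q < n"
      using that by (auto simp: c_def min_def split: if_splits)
    then show ?thesis
      using gt_pattern_le[OF assms] gt_pattern_ge[OF assms] that by simp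
  qed
  moreover have "c n = n"
    by (simp add: c_def)
  ultimately show ?thesis
    using gt_pattern_top[OF assms] unfolding mem_gt_patterns_iff state by auto
qed

lemma gt_climb_state_0: "\<xi> \<in> gt_patterns n m \<Longrightarrow> gt_climb_state n \<xi> 0 1 = \<xi>"
  using gt_pattern_zero[of \<xi> n m] by (auto simp: gt_climb_state_def fun_eq_iff)

lemma gt_climb_state_last:
  "\<xi> \<in> gt_patterns n m \<Longrightarrow> gt_climb_state n \<xi> (n - 1) 1 = gt_top_pattern n m"
  using gt_pattern_top[of \<xi> n m] by (auto simp: gt_climb_state_def gt_top_pattern_def fun_eq_iff min_def)

text \<open>Rows from \<open>n - s\<close> on already hold entries of the top row, so a block is
  complete once the rows below \<open>n - s\<close> are raised; hence the shrinking blocks of the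
  word.\<close>

lemma gt_climb_state_Suc: "gt_climb_state n \<xi> s (n - s) = gt_climb_state n \<xi> (Suc s) 1"
  by (auto simp: gt_climb_state_def fun_eq_iff min_def)

text \<open>Row \<open>k + 1\<close>, not yet raised in this block, holds exactly the entries that
  row \<open>k\<close> is to receive.\<close>

lemma gt_raise_climb_state:
  "k < n \<Longrightarrow> gt_raise k (gt_climb_state n \<xi> s k) = gt_climb_state n \<xi> s (Suc k)"
  by (auto simp: gt_raise_def gt_climb_state_def fun_eq_iff less_Suc_eq)

text \<open>Before row \<open>k\<close> is raised, rows \<open>k\<close> and \<open>k + 1\<close>
  come from rows \<open>k + s\<close> and \<open>k + s + 1\<close> of \<open>\<xi>\<close>; the
  bound on \<open>k + s\<close> keeps the cap at \<open>n\<close> inactive.\<close>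

lemma gt_gap_climb_state:
  "k + s < n \<Longrightarrow> gt_gap k (gt_climb_state n \<xi> s k) = (\<Sum>i=1..k. \<xi> i (Suc (k + s)) - \<xi> i (k + s))"
  unfolding gt_gap_def by (intro sum.cong) (auto simp: gt_climb_state_def)

text \<open>Downward induction prepends the letter \<open>k + 1\<close>, which raises row
  \<open>k\<close>; at \<open>k = n - s\<close> the next block begins.\<close>

lemma gt_climb_block:
  assumes "\<xi> \<in> gt_patterns n m" "k \<le> n - s"
    and "gt_climb n m ks (gt_climb_state n \<xi> (Suc s) 1) as \<zeta>"
  shows "gt_climb n m ([Suc k..<Suc (n - s)] @ ks) (gt_climb_state n \<xi> s k)
    (map (\<lambda>k. nat (gt_gap k (gt_climb_state n \<xi> s k))) [k..<n - s] @ as) \<zeta>"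
  using assms(2)
proof (induction k rule: inc_induct)
  case base
  then show ?case using assms(3) by (simp add: gt_climb_state_Suc)
next
  case (step k)
  then have "gt_climb n m (Suc k # [Suc (Suc k)..<Suc (n - s)] @ ks) (gt_climb_state n \<xi> s k)
    (nat (gt_gap k (gt_climb_state n \<xi> s k)) #
      map (\<lambda>k. nat (gt_gap k (gt_climb_state n \<xi> s k))) [Suc k..<n - s] @ as) \<zeta>"
    using gt_climb_state_in_gt_patterns[OF assms(1)]
    by (intro gt_climb.intros) (simp_all add: gt_raise_climb_state)
  with step.hyps show ?case
    by (simp add: upt_conv_Cons del: upt_Suc)
qed

lemma gt_climb_blocks:
  assumes "\<xi> \<in> gt_patterns n m" "s \<le> n - 1" "1 \<le> n"
  shows "gt_climb n m (concat (map (\<lambda>r. [2..<r+2]) (rev [1..<n - s]))) (gt_climb_state n \<xi> s 1)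
    (concat (map (\<lambda>s. map (\<lambda>k. nat (gt_gap k (gt_climb_state n \<xi> s k))) [1..<n - s]) [s..<n - 1]))
    (gt_climb_state n \<xi> (n - 1) 1)"
  using assms(2)
proof (induction s rule: inc_induct)
  case base
  show ?case using assms(3) by (simp add: gt_climb_Nil)
next
  case (step s)
  \<comment> \<open>The longest remaining block, \<open>r = n - s - 1\<close>, is split off;
    reversal puts it first.\<close>
  have "[1..<n - s] = [1..<n - Suc s] @ [n - Suc s]"
    using step.hyps upt_Suc_append[of 1 "n - Suc s"] by (simp add: Suc_diff_Suc)
  moreover have "Suc (Suc (n - Suc s)) = Suc (n - s)"
    using step.hyps by simp
  moreover note gt_climb_block[OF assms(1) _ step.IH, of 1]
  ultimately show ?case
    using step.hyps by (simp add: upt_conv_Cons[of s] numeral_2_eq_2 del: upt_Suc)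
qed

lemma gt_climb_word:
  assumes "\<xi> \<in> gt_patterns n m" "1 \<le> n"
  shows "gt_climb n m (gt_word n) \<xi>
    (concat (map (\<lambda>s. map (\<lambda>k. nat (gt_gap k (gt_climb_state n \<xi> s k))) [1..<n - s]) [0..<n - 1]))
    (gt_top_pattern n m)"
  using gt_climb_blocks[OF assms(1) _ assms(2), of 0]
  by (simp add: gt_word_def gt_climb_state_0[OF assms(1)] gt_climb_state_last[OF assms(1)] del: One_nat_def)

lemma gt_exponent_eq:
  assumes "\<xi> \<in> gt_patterns n m" "1 \<le> n"
  shows "gt_exponent n m \<xi> =
    concat (map (\<lambda>s. map (\<lambda>k. nat (gt_gap k (gt_climb_state n \<xi> s k))) [1..<n - s]) [0..<n - 1])"
  using gt_climb_max_exponents[OF gt_climb_word[OF assms], of 1] by (simp add: gt_exponent_def)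

lemma gt_climb_exponent:
  assumes "\<xi> \<in> gt_patterns n m" "1 \<le> n"
  shows "gt_climb n m (gt_word n) \<xi> (gt_exponent n m \<xi>) (gt_top_pattern n m)"
  unfolding gt_exponent_eq[OF assms] by (rule gt_climb_word[OF assms])

lemma inj_on_gt_exponent:
  assumes "1 \<le> n"
  shows "inj_on (gt_exponent n m) (gt_patterns n m)"
proof (rule inj_onI)
  fix \<xi> \<eta> assume \<xi>: "\<xi> \<in> gt_patterns n m" and \<eta>: "\<eta> \<in> gt_patterns n m"
    and eq: "gt_exponent n m \<xi> = gt_exponent n m \<eta>"
  \<comment> \<open>Both exponent lists become maps over one list of index pairs, so their equality
    is pointwise.\<close>
  define g where "g \<xi> = (\<lambda>(s, k). nat (gt_gap k (gt_climb_state n \<xi> s k)))" for \<xi>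
  have "gt_exponent n m \<zeta> = map (g \<zeta>) (concat (map (\<lambda>s. map (Pair s) [1..<n - s]) [0..<n - 1]))"
    if "\<zeta> \<in> gt_patterns n m" for \<zeta>
    by (simp add: gt_exponent_eq[OF that assms] map_concat comp_def g_def)
  with \<xi> \<eta> eq have "\<forall>x\<in>set (concat (map (\<lambda>s. map (Pair s) [1..<n - s]) [0..<n - 1])). g \<xi> x = g \<eta> x"
    by (simp only: map_eq_conv)
  then have g: "g \<xi> (s, k) = g \<eta> (s, k)" if "1 \<le> k" "k < n - s" for s k
    using that by simp
  \<comment> \<open>Descending from the common top row: the exponent at block \<open>q - k\<close>,
    row \<open>k\<close>, is the change of this partial sum from row \<open>q\<close> to row
    \<open>q + 1\<close>.\<close>
  have "(\<Sum>i=1..k. \<xi> i q) = (\<Sum>i=1..k. \<eta> i q)" if "1 \<le> k" "k \<le> q" "q \<le> n" for k q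
    using that(3,2)
  proof (induction q rule: inc_induct)
    case base
    then show ?case
      using gt_pattern_top[OF \<xi>] gt_pattern_top[OF \<eta>] by (intro sum.cong) auto
  next
    case (step q)
    have "k < n - (q - k)"
      using step.hyps step.prems by linarith
    have "gt_gap k (gt_climb_state n \<xi> (q - k) k) = gt_gap k (gt_climb_state n \<eta> (q - k) k)"
      using g[OF that(1) \<open>k < n - (q - k)\<close>] gt_gap_nonneg[OF gt_climb_state_in_gt_patterns[OF \<xi>], of k "q - k" k]
        gt_gap_nonneg[OF gt_climb_state_in_gt_patterns[OF \<eta>], of k "q - k" k]
        that(1) step.hyps step.prems
      by (auto simp: g_def)
    then show ?case
      using step by (simp add: gt_gap_climb_state sum_subtractf)
  qed
  \<comment> \<open>With \<open>k = 0\<close> included, the first entry of a row is also a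
    difference of consecutive partial sums.\<close>
  then have sums: "(\<Sum>i=1..k. \<xi> i q) = (\<Sum>i=1..k. \<eta> i q)" if "k \<le> q" "q \<le> n" for k q
    using that by (cases "k = 0") auto
  show "\<xi> = \<eta>"
  proof (intro ext)
    fix i q
    show "\<xi> i q = \<eta> i q"
    proof (cases "1 \<le> i \<and> i \<le> q \<and> q \<le> n")
      case True
      then show ?thesis
        using sums[of i q] sums[of "i - 1" q] by (cases i) auto
    next
      case False
      then show ?thesis
        using gt_pattern_zero[OF \<xi>] gt_pattern_zero[OF \<eta>] by simp
    qed
  qed
qed

subsection \<open>The basis\<close>

text \<open>In a linear relation, take \<open>j\<close> with \<open>a j\<close> least among the
  indices with nonzero coefficient. At \<open>j\<close> only terms with \<open>a k \<le> a j\<close>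
  survive, so by minimality and injectivity of \<open>a\<close> only \<open>k = j\<close>, whose
  diagonal coefficient is nonzero.\<close>

lemma triangular_independent:
  fixes v :: "gt_array \<Rightarrow> gt_vec" and a :: "gt_array \<Rightarrow> 'b :: linorder"
  assumes "finite P" "inj_on a P"
    and diag: "\<And>i. i \<in> P \<Longrightarrow> Poly_Mapping.lookup (v i) i \<noteq> 0"
    and tri: "\<And>i j. i \<in> P \<Longrightarrow> j \<in> P \<Longrightarrow> Poly_Mapping.lookup (v i) j \<noteq> 0 \<Longrightarrow> a i \<le> a j"
  shows "inj_on v P" "gt.independent (v ` P)"
proof -
  \<comment> \<open>If \<open>v i = v j\<close>, the diagonal condition makes the coefficients at
    both \<open>i\<close> and \<open>j\<close> nonzero, whence \<open>a i = a j\<close>.\<close>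
  show inj: "inj_on v P"
    using diag tri \<open>inj_on a P\<close> by (metis (lifting) inj_on_def order_antisym)
  show "gt.independent (v ` P)"
  proof (rule gt.independent_if_scalars_zero)
    fix u x assume sum: "(\<Sum>x\<in>v ` P. gt_scale (u x) x) = 0" and "x \<in> v ` P"
    have "u (v i) = 0" if "i \<in> P" for i
    proof (rule ccontr)
      assume "u (v i) \<noteq> 0"
      define Q where "Q = {i \<in> P. u (v i) \<noteq> 0}"
      have "finite Q" "Q \<noteq> {}"
        using \<open>finite P\<close> \<open>i \<in> P\<close> \<open>u (v i) \<noteq> 0\<close> by (auto simp: Q_def)
      then obtain j where j: "j \<in> Q" "\<And>k. k \<in> Q \<Longrightarrow> a j \<le> a k"
        using arg_min_if_finite(1)[of Q a] arg_min_least[of Q _ a] by blast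
      have "0 = (\<Sum>k\<in>P. u (v k) * Poly_Mapping.lookup (v k) j)"
        using arg_cong[OF sum, of "\<lambda>w. Poly_Mapping.lookup w j"]
        by (simp add: sum.reindex[OF inj] lookup_sum)
      also have "\<dots> = (\<Sum>k\<in>P. if k = j then u (v j) * Poly_Mapping.lookup (v j) j else 0)"
      proof (intro sum.cong refl)
        fix k assume "k \<in> P"
        show "u (v k) * Poly_Mapping.lookup (v k) j =
          (if k = j then u (v j) * Poly_Mapping.lookup (v j) j else 0)"
          using j tri[OF \<open>k \<in> P\<close>, of j] \<open>k \<in> P\<close> inj_onD[OF \<open>inj_on a P\<close>, of k j]
          by (cases "k \<in> Q") (auto simp: Q_def dest: order_antisym)
      qed
      also have "\<dots> \<noteq> 0"
        using j(1) \<open>finite P\<close> diag by (simp add: Q_def)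
      finally show False by simp
    qed
    with \<open>x \<in> v ` P\<close> show "u x = 0" by auto
  qed (use \<open>finite P\<close> in simp)
qed

theorem lemma4p1p6:
  fixes n :: nat and m :: "nat \<Rightarrow> int" and \<beta> :: gt_vec and B :: "nat list set"
  assumes "n \<ge> 2"
    and "\<And>i j. 1 \<le> i \<Longrightarrow> i \<le> j \<Longrightarrow> j \<le> n \<Longrightarrow> m i \<ge> m j"
  defines "\<beta> \<equiv> gt_basis_vec (gt_top_pattern n m)"
    and "B \<equiv> {gt_exponent n m \<xi> | \<xi>. \<xi> \<in> gt_patterns n m}"
  shows "gt.independent {gt_F_monomial n m a \<beta> | a. a \<in> B} \<and>
         gt.span {gt_F_monomial n m a \<beta> | a. a \<in> B} = gt_space n m"
proof -
  let ?P = "gt_patterns n m"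
  define v where "v \<xi> = gt_F_monomial n m (gt_exponent n m \<xi>) \<beta>" for \<xi>
  have set_eq: "{gt_F_monomial n m a \<beta> | a. a \<in> B} = v ` ?P"
    by (auto simp: B_def v_def)
  have "1 \<le> n" using \<open>n \<ge> 2\<close> by simp
  note climb = gt_climb_exponent[OF _ \<open>1 \<le> n\<close>, of _ m]
  have basis_in: "gt_basis_vec \<xi> \<in> gt_space n m" if "\<xi> \<in> ?P" for \<xi>
    using that by (simp add: gt_space_def gt_basis_vec_def)
  \<comment> \<open>The top pattern is the last state of the climb from
    \<open>\<xi>\<close>.\<close>
  have top: "gt_top_pattern n m \<in> ?P" if "\<xi> \<in> ?P" for \<xi>
    using gt_climb_state_in_gt_patterns[OF that] gt_climb_state_last[OF that] by metis
  have v_in: "v \<xi> \<in> gt_space n m" if "\<xi> \<in> ?P" for \<xi>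
    unfolding v_def gt_F_monomial_def \<beta>_def
    using top[OF that] by (intro gt_word_F_in_gt_space basis_in)
  have lookup_v: "Poly_Mapping.lookup (v \<xi>) \<eta> = Poly_Mapping.lookup
      (gt_word_E n m (zip (gt_word n) (gt_exponent n m \<xi>)) (gt_basis_vec \<eta>)) (gt_top_pattern n m)"
    if "\<xi> \<in> ?P" "\<eta> \<in> ?P" for \<xi> \<eta>
    using gt_pairing_gt_word_F[OF basis_in[OF top[OF that(1)]] basis_in[OF that(2)]]
    by (simp add: v_def gt_F_monomial_def \<beta>_def gt_pairing_basis_vec that top[OF that(1)])
  have diag: "Poly_Mapping.lookup (v \<xi>) \<xi> \<noteq> 0" if "\<xi> \<in> ?P" for \<xi>
    using gt_climb_word_E[OF climb[OF that], of 1]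
    by (auto simp: lookup_v[OF that that]) (simp add: gt_basis_vec_def)
  have tri: "gt_exponent n m \<xi> \<le> gt_exponent n m \<eta>"
    if "\<xi> \<in> ?P" "\<eta> \<in> ?P" "Poly_Mapping.lookup (v \<xi>) \<eta> \<noteq> 0" for \<xi> \<eta>
    using that(3) lookup_v[OF that(1,2)]
    by (intro gt_climb_lex_max[OF climb[OF that(2)], of 1])
      (auto simp: length_gt_exponent length_gt_word)
  note triangular = triangular_independent[OF finite_gt_patterns inj_on_gt_exponent[OF \<open>1 \<le> n\<close>] diag tri]
  then have inj: "inj_on v ?P" and indep: "gt.independent (v ` ?P)" by auto
  \<comment> \<open>Dimension count: a vector outside the span would enlarge the family to an
    independent set with more elements than the spanning set of pattern vectors.\<close>
  have "w \<in> gt.span (v ` ?P)" if "w \<in> gt_space n m" for w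
  proof (rule ccontr)
    assume w: "w \<notin> gt.span (v ` ?P)"
    have "insert w (v ` ?P) \<subseteq> gt.span (gt_basis_vec ` ?P)"
      using that v_in by (auto simp flip: gt_space_eq_span)
    then have "card (insert w (v ` ?P)) \<le> card (gt_basis_vec ` ?P)"
      using gt.independent_span_bound[OF _ gt.independent_insertI[OF w indep]] finite_gt_patterns by blast
    also have "\<dots> \<le> card (v ` ?P)"
      using finite_gt_patterns by (simp add: card_image[OF inj] card_image_le)
    finally show False
      using w gt.span_base[of w "v ` ?P"] finite_gt_patterns[of n m] by (auto simp: card_insert_if split: if_splits)
  qed
  moreover have "gt.span (v ` ?P) \<subseteq> gt_space n m"
    using v_in unfolding gt_space_eq_span by (intro gt.span_minimal gt.subspace_span) auto
  ultimately show ?thesis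
    unfolding set_eq using indep by blast
qed

end
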